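(* Let $n\ge 2$, let $(t_0,u_0,t,t_n,u_n)\in\mathbb C^5$, and let $H\subset\mathfrak H(\mathbf k)$ be the algebra generated by $T_0,T_1,\dots,T_n$ defined in the context. Then the following relations hold in $H$. Quadratic relations: $T_i^2=t_i^2$ for $i=0,n$, and $T_i^2=1$ for $i\in[1,n-1]$. Braid-type relations: $$T_iT_{i+1}T_iT_{i+1}+t\,T_iT_{i+1}=T_{i+1}T_iT_{i+1}T_i+t\,T_{i+1}T_i,\qquad i=0,\,n-1,$$ $$T_iT_{i+1}T_i=T_{i+1}T_iT_{i+1},\qquad i\in[1,n-2],$$ $$T_iT_j=T_jT_i,\qquad i,j\in[0,n],\ |i-j|\ge 2.$$
   Context: Notation: $[m,n]=\{m,m+1,\dots,n\}$. $W$ is the affine Weyl group of type $\widetilde C_n$: the Coxeter group with generators $s_0,\dots,s_n$ and relations $s_i^2=1$; $s_is_{i+1}s_is_{i+1}=s_{i+1}s_is_{i+1}s_i$ for $i=0,n-1$; $s_is_{i+1}s_i=s_{i+1}s_is_{i+1}$ for $i\in[1,n-2]$; $s_is_j=s_js_i$ for $|i-j|\ge2$. $W$ acts on $\mathbb C^n$ by $s_0x=(1-x_1,x_2,\dots,x_n)$, $s_i$ interchanges $x_i$ and $x_{i+1}$ ($i\in[1,n-1]$), $s_nx=(x_1,\dots,x_{n-1},-x_n)$, and on $\mathcal P=\mathbb C[x_1,\dots,x_n]$ by $(wp)(x)=p(w^{-1}x)$. Put $a_0(x)=1-2x_1$, $a_i(x)=x_i-x_{i+1}$ ($i\in[1,n-1]$),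 $a_n(x)=2x_n$, and $a_0^\vee(x)=\tfrac12-x_1$, $a_n^\vee(x)=x_n$. Put $k_0=2t_0+2u_0$, $k_i=t$ for $i\in[1,n-1]$, $k_n=2t_n+2u_n$. The degenerate (trigonometric) double affine Hecke algebra $\mathfrak H(\mathbf k)$ is the unital associative complex algebra generated by the group algebra $\mathbb C[W]$ (with generators $r_0,\dots,r_n$ corresponding to $s_0,\dots,s_n$) and the polynomial algebra $\mathbb C[X_1,\dots,X_n]$, such that $\mathfrak H(\mathbf k)\simeq\mathbb C[W]\otimes\mathbb C[X_1,\dots,X_n]$ as a vector space via multiplication, with cross-relations $$r_ip(X)-(s_ip)(X)r_i=\frac{k_i}{a_i(X)}\big((s_ip)(X)-p(X)\big),\qquad i\in[0,n],\ p\in\mathcal P .$$ $H$ is the subalgebra of $\mathfrak H(\mathbf k)$ generated by $T_i=r_i$ ($i\in[1,n-1]$) and $T_i=t_i+\tfrac12\big(t_i-u_i+a_i^\vee(X)\big)(r_i-1)$ for $i=0,n$. *)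

theory Defs
  imports Complex_Main "HOL-Library.Poly_Mapping" "HOL-Algebra.Group"
begin

section \<open>The affine Weyl group of type C\<close>

definition affine_C_relators :: "nat \<Rightarrow> (nat list \<times> nat list) set" where
  "affine_C_relators n =
     {([i, i], []) |i. i \<le> n} \<union>
     {([i, i+1, i, i+1], [i+1, i, i+1, i]) |i. i = 0 \<or> i = n - 1} \<union>
     {([i, i+1, i], [i+1, i, i+1]) |i. 1 \<le> i \<and> i \<le> n - 2} \<union>
     {([i, j], [j, i]) |i j. i \<le> n \<and> j \<le> n \<and> \<bar>int i - int j\<bar> \<ge> 2}"

text \<open>The word \<open>[i, j, \<dots>]\<close> stands for the product of the generators with indices \<open>i\<close>, \<open>j\<close>, \<open>\<dots>\<close>.
  No inverse letters are needed, because the relators make every generator an involution.\<close>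

inductive_set affine_C_cong :: "nat \<Rightarrow> (nat list \<times> nat list) set" for n where
  relator: "\<lbrakk>(u, v) \<in> affine_C_relators n; a \<in> lists {0..n}; b \<in> lists {0..n};
     u \<in> lists {0..n}; v \<in> lists {0..n}\<rbrakk> \<Longrightarrow> (a @ u @ b, a @ v @ b) \<in> affine_C_cong n"
| refl: "a \<in> lists {0..n} \<Longrightarrow> (a, a) \<in> affine_C_cong n"
| sym: "(a, b) \<in> affine_C_cong n \<Longrightarrow> (b, a) \<in> affine_C_cong n"
| trans: "\<lbrakk>(a, b) \<in> affine_C_cong n; (b, c) \<in> affine_C_cong n\<rbrakk> \<Longrightarrow> (a, c) \<in> affine_C_cong n"

definition affine_C :: "nat \<Rightarrow> nat list set monoid" where
  "affine_C n =
     \<lparr>carrier = lists {0..n} // affine_C_cong n,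
      mult = (\<lambda>u v. \<Union>a\<in>u. \<Union>b\<in>v. affine_C_cong n `` {a @ b}),
      one = affine_C_cong n `` {[]}\<rparr>"

definition affine_C_gen :: "nat \<Rightarrow> nat \<Rightarrow> nat list set" where
  "affine_C_gen n i = affine_C_cong n `` {[i]}"

lemma affine_C_cong_lists:
  "(a, b) \<in> affine_C_cong n \<Longrightarrow> a \<in> lists {0..n} \<and> b \<in> lists {0..n}"
  by (induction rule: affine_C_cong.induct) auto

lemma equiv_affine_C_cong: "equiv (lists {0..n}) (affine_C_cong n)"
proof (rule equivI)
  show "affine_C_cong n \<subseteq> lists {0..n} \<times> lists {0..n}"
    by (rule subrelI) (simp only: mem_Times_iff fst_conv snd_conv affine_C_cong_lists)
  show "refl_on (lists {0..n}) (affine_C_cong n)"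
    by (rule refl_onI) (rule affine_C_cong.refl)
  show "sym (affine_C_cong n)"
    by (rule symI) (rule affine_C_cong.sym)
  show "trans (affine_C_cong n)"
    by (rule transI) (rule affine_C_cong.trans)
qed

lemma affine_C_cong_append_left:
  assumes "(a, b) \<in> affine_C_cong n" "c \<in> lists {0..n}"
  shows "(c @ a, c @ b) \<in> affine_C_cong n"
  using assms
proof (induction rule: affine_C_cong.induct)
  case (relator u v a b)
  then show ?case using affine_C_cong.relator[of u v n "c @ a" b] by auto
next
  case (refl a)
  then show ?case by (intro affine_C_cong.refl) simp
next
  case (sym a b)
  then show ?case using affine_C_cong.sym by blast
next
  case (trans a b c)
  then show ?case using affine_C_cong.trans by blast
qed

lemma affine_C_cong_append_right:
  assumes "(a, b) \<in> affine_C_cong n" "c \<in> lists {0..n}"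
  shows "(a @ c, b @ c) \<in> affine_C_cong n"
  using assms
proof (induction rule: affine_C_cong.induct)
  case (relator u v a b)
  then show ?case using affine_C_cong.relator[of u v n a "b @ c"] by auto
next
  case (refl a)
  then show ?case by (intro affine_C_cong.refl) simp
next
  case (sym a b)
  then show ?case using affine_C_cong.sym by blast
next
  case (trans a b c)
  then show ?case using affine_C_cong.trans by blast
qed

lemma affine_C_cong_append:
  assumes "(a, a') \<in> affine_C_cong n" "(b, b') \<in> affine_C_cong n"
  shows "(a @ b, a' @ b') \<in> affine_C_cong n"
proof (rule affine_C_cong.trans)
  show "(a @ b, a' @ b) \<in> affine_C_cong n"
    using affine_C_cong_append_right[OF assms(1)] affine_C_cong_lists[OF assms(2)] by simp
  show "(a' @ b, a' @ b') \<in> affine_C_cong n"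
    using affine_C_cong_append_left[OF assms(2)] affine_C_cong_lists[OF assms(1)] by simp
qed

lemma affine_C_mult:
  assumes "a \<in> lists {0..n}" "b \<in> lists {0..n}"
  shows "affine_C_cong n `` {a} \<otimes>\<^bsub>affine_C n\<^esub> affine_C_cong n `` {b} = affine_C_cong n `` {a @ b}"
proof -
  have eq: "affine_C_cong n `` {a' @ b'} = affine_C_cong n `` {a @ b}"
    if "a' \<in> affine_C_cong n `` {a}" "b' \<in> affine_C_cong n `` {b}" for a' b'
    using that equiv_class_eq[OF equiv_affine_C_cong affine_C_cong_append, of a a' n b b'] by simp
  have mem: "a \<in> affine_C_cong n `` {a}" "b \<in> affine_C_cong n `` {b}"
    using assms by (simp_all add: affine_C_cong.refl)
  have "(\<Union>a'\<in>affine_C_cong n `` {a}. \<Union>b'\<in>affine_C_cong n `` {b}. affine_C_cong n `` {a' @ b'})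
      = (\<Union>a'\<in>affine_C_cong n `` {a}. \<Union>b'\<in>affine_C_cong n `` {b}. affine_C_cong n `` {a @ b})"
    by (intro SUP_cong HOL.refl eq)
  also have "\<dots> = affine_C_cong n `` {a @ b}"
    using mem by blast
  finally show ?thesis by (simp add: affine_C_def)
qed

lemma affine_C_class_carrier:
  "a \<in> lists {0..n} \<Longrightarrow> affine_C_cong n `` {a} \<in> carrier (affine_C n)"
  by (simp add: affine_C_def quotientI)

lemma affine_C_carrierE:
  assumes "u \<in> carrier (affine_C n)"
  obtains a where "a \<in> lists {0..n}" "u = affine_C_cong n `` {a}"
proof -
  have "u \<in> lists {0..n} // affine_C_cong n" using assms by (simp add: affine_C_def)
  then show thesis by (rule quotientE) (rule that)
qed

lemma affine_C_cong_rev: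
  assumes "a \<in> lists {0..n}"
  shows "(rev a @ a, []) \<in> affine_C_cong n"
  using assms
proof (induction a rule: list.induct)
  case Nil
  then show ?case by (auto intro: affine_C_cong.refl)
next
  case (Cons i a)
  have "i \<le> n" using Cons.prems by simp
  then have "([i, i], []) \<in> affine_C_relators n"
    by (simp add: affine_C_relators_def)
  then have "(rev a @ [i, i] @ a, rev a @ [] @ a) \<in> affine_C_cong n"
    using Cons.prems by (intro affine_C_cong.relator) (auto simp: in_lists_conv_set)
  then have "(rev (i # a) @ i # a, rev a @ a) \<in> affine_C_cong n" by simp
  moreover have "(rev a @ a, []) \<in> affine_C_cong n" using Cons by simp
  ultimately show ?case by (rule affine_C_cong.trans)
qed

lemma group_affine_C: "group (affine_C n)"
proof (rule groupI)
  have one: "\<one>\<^bsub>affine_C n\<^esub> = affine_C_cong n `` {[]}"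
    by (simp add: affine_C_def)
  show "\<one>\<^bsub>affine_C n\<^esub> \<in> carrier (affine_C n)"
    unfolding one by (rule affine_C_class_carrier) simp
  fix u assume "u \<in> carrier (affine_C n)"
  then obtain a where a: "a \<in> lists {0..n}" "u = affine_C_cong n `` {a}"
    by (rule affine_C_carrierE)
  show "\<one>\<^bsub>affine_C n\<^esub> \<otimes>\<^bsub>affine_C n\<^esub> u = u"
    using a affine_C_mult[of "[]" n a] by (simp add: one)
  have rev: "rev a \<in> lists {0..n}" using a(1) by (simp add: in_lists_conv_set)
  have "affine_C_cong n `` {rev a} \<otimes>\<^bsub>affine_C n\<^esub> u = \<one>\<^bsub>affine_C n\<^esub>"
    using affine_C_mult[OF rev a(1)] a(2)
      equiv_class_eq[OF equiv_affine_C_cong affine_C_cong_rev[OF a(1)]]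
    by (simp add: one)
  then show "\<exists>v\<in>carrier (affine_C n). v \<otimes>\<^bsub>affine_C n\<^esub> u = \<one>\<^bsub>affine_C n\<^esub>"
    using affine_C_class_carrier[OF rev] by (rule bexI)
  fix v assume "v \<in> carrier (affine_C n)"
  then obtain b where b: "b \<in> lists {0..n}" "v = affine_C_cong n `` {b}"
    by (rule affine_C_carrierE)
  have ab: "a @ b \<in> lists {0..n}" using a(1) b(1) by simp
  show "u \<otimes>\<^bsub>affine_C n\<^esub> v \<in> carrier (affine_C n)"
    unfolding a(2) b(2) affine_C_mult[OF a(1) b(1)] by (rule affine_C_class_carrier[OF ab])
  fix w assume "w \<in> carrier (affine_C n)"
  then obtain c where c: "c \<in> lists {0..n}" "w = affine_C_cong n `` {c}"
    by (rule affine_C_carrierE)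
  have bc: "b @ c \<in> lists {0..n}" using b(1) c(1) by simp
  show "u \<otimes>\<^bsub>affine_C n\<^esub> v \<otimes>\<^bsub>affine_C n\<^esub> w = u \<otimes>\<^bsub>affine_C n\<^esub> (v \<otimes>\<^bsub>affine_C n\<^esub> w)"
    unfolding a(2) b(2) c(2) affine_C_mult[OF a(1) b(1)] affine_C_mult[OF b(1) c(1)]
      affine_C_mult[OF ab c(1)] affine_C_mult[OF a(1) bc] by simp
qed

section \<open>Polynomials and the action of the simple reflections\<close>

type_synonym mpoly = "(nat \<Rightarrow>\<^sub>0 nat) \<Rightarrow>\<^sub>0 complex"

definition Polys :: "nat \<Rightarrow> mpoly set" where
  "Polys n = {p. \<forall>m\<in>Poly_Mapping.keys p. Poly_Mapping.keys m \<subseteq> {1..n}}"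

definition Var :: "nat \<Rightarrow> mpoly" where
  "Var j = Poly_Mapping.single (Poly_Mapping.single j 1) 1"

definition cmul :: "complex \<Rightarrow> mpoly \<Rightarrow> mpoly" where
  "cmul c p = Poly_Mapping.single 0 c * p"

text \<open>\<open>peval n scale x p\<close> is \<open>p(x\<^sub>1, \<dots>, x\<^sub>n)\<close> for elements \<open>x\<^sub>j\<close> of any complex algebra with
  scalar multiplication \<open>scale\<close>. The factors of a monomial are multiplied in the order of the
  indices, which only matters if the \<open>x\<^sub>j\<close> do not commute.\<close>

definition peval :: "nat \<Rightarrow> (complex \<Rightarrow> 'a \<Rightarrow> 'a) \<Rightarrow> (nat \<Rightarrow> 'a::ring_1) \<Rightarrow> mpoly \<Rightarrow> 'a" where
  "peval n scale x p =
     (\<Sum>m\<in>Poly_Mapping.keys p. scale (Poly_Mapping.lookup p m) (\<Prod>j\<leftarrow>[1..<Suc n]. x j ^ Poly_Mapping.lookup m j))"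

text \<open>The two functions below are polymorphic, so that they apply to points of \<open>\<complex>\<^sup>n\<close> as well as to
  the tuple of the polynomial variables.\<close>

definition reflect :: "nat \<Rightarrow> nat \<Rightarrow> (nat \<Rightarrow> 'a::ring_1) \<Rightarrow> nat \<Rightarrow> 'a" where
  "reflect n i x =
     (if i = 0 then x(1 := 1 - x 1)
      else if i = n then x(n := - x n)
      else x(i := x (i+1), i+1 := x i))"

definition affine_root :: "nat \<Rightarrow> nat \<Rightarrow> (nat \<Rightarrow> 'a::ring_1) \<Rightarrow> 'a" where
  "affine_root n i x =
     (if i = 0 then 1 - 2 * x 1
      else if i = n then 2 * x n
      else x i - x (i+1))"

text \<open>\<open>(s\<^sub>i p)(x) = p(s\<^sub>i\<^sup>-\<^sup>1 x) = p(s\<^sub>i x)\<close>, as a polynomial: substitute \<open>s\<^sub>i(x\<^sub>1, \<dots>, x\<^sub>n)\<close> in \<open>p\<close>.\<close>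

definition reflect_poly :: "nat \<Rightarrow> nat \<Rightarrow> mpoly \<Rightarrow> mpoly" where
  "reflect_poly n i p = peval n cmul (reflect n i Var) p"

section \<open>The degenerate double affine Hecke algebra\<close>

locale complex_algebra = vector_space scale
  for scale :: "complex \<Rightarrow> 'a::ring_1 \<Rightarrow> 'a" +
  assumes scale_mult_left: "scale c x * y = scale c (x * y)"
    and scale_mult_right: "x * scale c y = scale c (x * y)"

inductive_set subalgebra_gen :: "(complex \<Rightarrow> 'a \<Rightarrow> 'a) \<Rightarrow> 'a::ring_1 set \<Rightarrow> 'a set"
  for scale S where
  gen: "x \<in> S \<Longrightarrow> x \<in> subalgebra_gen scale S"
| one: "1 \<in> subalgebra_gen scale S"
| add: "\<lbrakk>x \<in> subalgebra_gen scale S; y \<in> subalgebra_gen scale S\<rbrakk> \<Longrightarrow> x + y \<in> subalgebra_gen scale S"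
| mult: "\<lbrakk>x \<in> subalgebra_gen scale S; y \<in> subalgebra_gen scale S\<rbrakk> \<Longrightarrow> x * y \<in> subalgebra_gen scale S"
| scale: "x \<in> subalgebra_gen scale S \<Longrightarrow> scale c x \<in> subalgebra_gen scale S"

definition daha_k ::
  "nat \<Rightarrow> complex \<Rightarrow> complex \<Rightarrow> complex \<Rightarrow> complex \<Rightarrow> complex \<Rightarrow> nat \<Rightarrow> complex" where
  "daha_k n t0 u0 t tn un i =
     (if i = 0 then 2 * t0 + 2 * u0 else if i = n then 2 * tn + 2 * un else t)"

text \<open>The algebra is characterised, up to unique isomorphism, inside an arbitrary complex algebra
  \<open>'a\<close>: \<open>\<rho>\<close> is the map from the group \<open>W\<close> (which extends to the group algebra \<open>\<complex>[W]\<close>), the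
  commuting elements \<open>X\<^sub>1, \<dots>, X\<^sub>n\<close> give the map from the polynomial algebra, and the algebra itself
  is the subalgebra generated by their images. The tensor product of \<open>\<complex>[W]\<close> with the polynomial
  algebra is represented by the finitely supported functions from \<open>W\<close> to polynomials,
  \<open>w \<otimes> p\<close> being the function with value \<open>p\<close> at \<open>w\<close> and \<open>0\<close> elsewhere.

  In \<open>cross\<close>, \<open>q\<close> is the quotient of \<open>s\<^sub>i p - p\<close> by \<open>a\<^sub>i\<close>; it is unique because \<^typ>\<open>mpoly\<close> is an
  integral domain, and it exists because \<open>s\<^sub>i p - p\<close> vanishes on the hyperplane fixed by \<open>s\<^sub>i\<close>.\<close>

locale degenerate_daha = complex_algebra scale
  for scale :: "complex \<Rightarrow> 'a::ring_1 \<Rightarrow> 'a" +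
  fixes n :: nat and t0 u0 t tn un :: complex
    and \<rho> :: "nat list set \<Rightarrow> 'a" and X :: "nat \<Rightarrow> 'a"
  assumes \<rho>_one: "\<rho> \<one>\<^bsub>affine_C n\<^esub> = 1"
    and \<rho>_mult: "\<lbrakk>v \<in> carrier (affine_C n); w \<in> carrier (affine_C n)\<rbrakk> \<Longrightarrow>
      \<rho> (v \<otimes>\<^bsub>affine_C n\<^esub> w) = \<rho> v * \<rho> w"
    and X_commute: "\<lbrakk>i \<in> {1..n}; j \<in> {1..n}\<rbrakk> \<Longrightarrow> X i * X j = X j * X i"
    and tensor: "bij_betw
      (\<lambda>f :: nat list set \<Rightarrow>\<^sub>0 mpoly. \<Sum>w\<in>Poly_Mapping.keys f. \<rho> w * peval n scale X (Poly_Mapping.lookup f w))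
      {f. Poly_Mapping.keys f \<subseteq> carrier (affine_C n) \<and> range (Poly_Mapping.lookup f) \<subseteq> Polys n}
      (subalgebra_gen scale (\<rho> ` carrier (affine_C n) \<union> X ` {1..n}))"
    and cross: "\<lbrakk>i \<in> {0..n}; p \<in> Polys n; q \<in> Polys n;
        affine_root n i Var * q = reflect_poly n i p - p\<rbrakk> \<Longrightarrow>
      \<rho> (affine_C_gen n i) * peval n scale X p
        - peval n scale X (reflect_poly n i p) * \<rho> (affine_C_gen n i)
      = scale (daha_k n t0 u0 t tn un i) (peval n scale X q)"

definition daha_T ::
  "(complex \<Rightarrow> 'a \<Rightarrow> 'a) \<Rightarrow> nat \<Rightarrow> complex \<Rightarrow> complex \<Rightarrow> complex \<Rightarrow> complex \<Rightarrow>
   (nat list set \<Rightarrow> 'a) \<Rightarrow> (nat \<Rightarrow> 'a) \<Rightarrow> nat \<Rightarrow> 'a::ring_1" where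
  "daha_T scale n t0 u0 tn un \<rho> X i =
     (let r = \<rho> (affine_C_gen n i) in
      if i = 0 then
        scale t0 1 + scale (1/2) ((scale (t0 - u0) 1 + (scale (1/2) 1 - X 1)) * (r - 1))
      else if i = n then
        scale tn 1 + scale (1/2) ((scale (tn - un) 1 + X n) * (r - 1))
      else r)"

definition daha_H ::
  "(complex \<Rightarrow> 'a \<Rightarrow> 'a) \<Rightarrow> nat \<Rightarrow> complex \<Rightarrow> complex \<Rightarrow> complex \<Rightarrow> complex \<Rightarrow>
   (nat list set \<Rightarrow> 'a) \<Rightarrow> (nat \<Rightarrow> 'a) \<Rightarrow> 'a::ring_1 set" where
  "daha_H scale n t0 u0 tn un \<rho> X =
     subalgebra_gen scale (daha_T scale n t0 u0 tn un \<rho> X ` {0..n})"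

end

theory Submission
  imports Defs
begin

text \<open>
  The end operators are \<open>T = a + D/2\<close> with \<open>D = (b + x) (s - 1)\<close>, where \<open>s x = - x s - k\<close>;
  here \<open>x = 1/2 - X\<^sub>1\<close> at the node \<open>0\<close> and \<open>x = X\<^sub>n\<close> at the node \<open>n\<close>. The quadratic relation
  amounts to \<open>D\<^sup>2 = - 4 a D\<close>. If \<open>r\<close> is the neighbouring reflection and \<open>y\<close> the image of \<open>x\<close> under
  it, then in both cases \<open>r x = y r + t\<close>, so one computation covers the two double braid relations:
  by \<open>r s r s = s r s r\<close> the element \<open>r T r\<close> commutes with \<open>T\<close> up to the terms produced by \<open>t\<close>,
  and these add up to \<open>t (T r - r T)\<close>.
\<close>

section \<open>Evaluation of polynomials\<close>

text \<open>In the monomial of a single variable every factor but one is 1; this is what evaluates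
  \<open>Var j\<close>.\<close>

lemma prod_list_map_if_eq:
  fixes x :: "'a::monoid_mult"
  assumes "distinct js" "j \<in> set js"
  shows "(\<Prod>i\<leftarrow>js. if i = j then x else 1) = x"
proof -
  have not_in: "(\<Prod>i\<leftarrow>ks. if i = j then x else 1) = 1" if "j \<notin> set ks" for ks
    using that by (induction ks) auto
  show ?thesis using assms by (induction js) (auto simp: not_in)
qed

context complex_algebra
begin

text \<open>Keys outside the support carry the coefficient 0, so several polynomials can be summed
  over one common index set; additivity follows from this.\<close>

lemma peval_superset:
  assumes "finite K" "Poly_Mapping.keys p \<subseteq> K"
  shows "peval n scale x p =
    (\<Sum>m\<in>K. scale (Poly_Mapping.lookup p m) (\<Prod>j\<leftarrow>[1..<Suc n]. x j ^ Poly_Mapping.lookup m j))"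
  unfolding peval_def
  by (rule sum.mono_neutral_left) (use assms in \<open>auto simp: in_keys_iff\<close>)

lemma peval_add: "peval n scale x (p + q) = peval n scale x p + peval n scale x q"
proof -
  let ?K = "Poly_Mapping.keys p \<union> Poly_Mapping.keys q"
  have "peval n scale x v =
      (\<Sum>m\<in>?K. scale (Poly_Mapping.lookup v m) (\<Prod>j\<leftarrow>[1..<Suc n]. x j ^ Poly_Mapping.lookup m j))"
    if "v \<in> {p, q, p + q}" for v
    by (rule peval_superset) (use that Poly_Mapping.keys_add[of p q] in auto)
  then show ?thesis by (simp add: lookup_add scale_left_distrib sum.distrib)
qed

lemma peval_zero [simp]: "peval n scale x 0 = 0"
  by (simp add: peval_def)

lemma peval_uminus: "peval n scale x (- p) = - peval n scale x p"
  using peval_add[of n x p "- p"] by (simp add: eq_neg_iff_add_eq_0 add.commute)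

lemma peval_diff: "peval n scale x (p - q) = peval n scale x p - peval n scale x q"
  using peval_add[of n x p "- q"] by (simp add: peval_uminus)

lemma peval_one [simp]: "peval n scale x 1 = 1"
proof -
  have "(\<Prod>j\<leftarrow>js. x j ^ Poly_Mapping.lookup 0 j) = 1" for js :: "nat list"
    by (induction js) auto
  then show ?thesis by (simp add: peval_def lookup_one del: upt_Suc)
qed

lemma peval_Var [simp]:
  assumes "j \<in> {1..n}"
  shows "peval n scale x (Var j) = x j"
proof -
  have "(\<lambda>i. x i ^ Poly_Mapping.lookup (Poly_Mapping.single j 1) i) = (\<lambda>i. if i = j then x j else 1)"
    by (auto simp: lookup_single when_def)
  then have "(\<Prod>i\<leftarrow>[1..<Suc n]. x i ^ Poly_Mapping.lookup (Poly_Mapping.single j 1) i) = x j"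
    using prod_list_map_if_eq[of "[1..<Suc n]" j "x j"] assms by (simp del: upt_Suc)
  then show ?thesis by (simp add: peval_def Var_def del: upt_Suc)
qed

end

text \<open>\<open>reflect_poly\<close> is an evaluation inside the polynomial ring itself, so the
  evaluation lemmas have to be available for \<open>cmul\<close> too.\<close>

interpretation mpoly: complex_algebra cmul
proof
  fix a b :: complex and x y :: mpoly
  show "cmul a (x + y) = cmul a x + cmul a y" by (simp add: cmul_def distrib_left)
  show "cmul (a + b) x = cmul a x + cmul b x"
    by (simp add: cmul_def single_add distrib_right)
  show "cmul a (cmul b x) = cmul (a * b) x"
    by (simp add: cmul_def mult_single flip: mult.assoc)
  show "cmul 1 x = x" by (simp add: cmul_def)
  show "cmul a x * y = cmul a (x * y)" by (simp add: cmul_def mult.assoc)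
  show "x * cmul a y = cmul a (x * y)" by (simp add: cmul_def mult.left_commute)
qed

lemma reflect_poly_Var: "j \<in> {1..n} \<Longrightarrow> reflect_poly n i (Var j) = reflect n i Var j"
  unfolding reflect_poly_def by (rule mpoly.peval_Var)

lemma Var_Polys: "j \<in> {1..n} \<Longrightarrow> Var j \<in> Polys n"
  by (simp add: Polys_def Var_def)

lemma zero_Polys: "0 \<in> Polys n"
  by (simp add: Polys_def)

lemma one_Polys: "1 \<in> Polys n"
  by (simp add: Polys_def)

lemma minus_one_Polys: "- 1 \<in> Polys n"
  by (simp add: Polys_def)

lemma affine_C_relatorI:
  shows "i \<le> n \<Longrightarrow> ([i, i], []) \<in> affine_C_relators n"
    and "i = 0 \<or> i = n - 1 \<Longrightarrow> ([i, i+1, i, i+1], [i+1, i, i+1, i]) \<in> affine_C_relators n"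
    and "1 \<le> i \<Longrightarrow> i \<le> n - 2 \<Longrightarrow> ([i, i+1, i], [i+1, i, i+1]) \<in> affine_C_relators n"
    and "i \<le> n \<Longrightarrow> j \<le> n \<Longrightarrow> \<bar>int i - int j\<bar> \<ge> 2 \<Longrightarrow> ([i, j], [j, i]) \<in> affine_C_relators n"
  by (auto simp: affine_C_relators_def)

section \<open>Relations between operators of Demazure-Lusztig type\<close>

text \<open>The rules below rewrite every word in \<open>z\<close>, \<open>w\<close>, \<open>r\<close>, \<open>s\<close> to a normal form with the polynomial part in
  front; a rule for \<open>s z\<close> is not needed, because no such factor arises from the two sides.\<close>

lemma ring_braid_relation:
  fixes z :: "'a::ring_1"
  assumes D: "D = z * (s - 1)"
    and s2: "s * s = 1" and r2: "r * r = 1"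
    and braid: "r * s * r * s = s * r * s * r"
    and sw: "s * w = w * s" and zw: "z * w = w * z"
    and rz: "r * z = w * r + \<tau>"
    and \<tau>: "\<And>v. v * \<tau> = \<tau> * v"
  shows "r * D * r * D + 2 * (\<tau> * (r * D)) = D * r * D * r + 2 * (\<tau> * (D * r))"
proof -
  \<comment> \<open>Multiplying \<open>rz\<close> by \<open>r\<close> on both sides gives the rule
    for \<open>r * w\<close>, with the opposite sign of \<open>\<tau>\<close>.\<close>
  have "r * (w * r + \<tau>) * r = r * (r * z) * r" by (simp add: rz)
  also have "\<dots> = z * r" using r2 by (simp flip: mult.assoc)
  finally have "r * w = z * r - \<tau> * (r * r)"
    by (simp add: distrib_left distrib_right mult.assoc \<tau> r2 eq_diff_eq)
  then have rw: "r * w = z * r - \<tau>" by (simp add: r2)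
  \<comment> \<open>Products get nested to the right, so each rule is repeated with an arbitrary
    tail \<open>v\<close>.\<close>
  have assoc_rules: "s * (s * v) = v" "r * (r * v) = v" "s * (w * v) = w * (s * v)"
    "z * (w * v) = w * (z * v)" "r * (z * v) = w * (r * v) + \<tau> * v"
    "r * (w * v) = z * (r * v) - \<tau> * v" "s * (r * (s * (r * v))) = r * (s * (r * (s * v)))" for v
    using s2 r2 sw zw rz rw braid
    by (simp_all flip: mult.assoc add: distrib_right left_diff_distrib)
  have \<tau>': "r * \<tau> = \<tau> * r" "s * \<tau> = \<tau> * s" "z * \<tau> = \<tau> * z" "w * \<tau> = \<tau> * w"
    "r * (\<tau> * v) = \<tau> * (r * v)" "s * (\<tau> * v) = \<tau> * (s * v)"
    "z * (\<tau> * v) = \<tau> * (z * v)" "w * (\<tau> * v) = \<tau> * (w * v)" for v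
    using \<tau> by (simp_all flip: mult.assoc)
  have braid': "s * (r * (s * r)) = r * (s * (r * s))" using braid by (simp add: mult.assoc)
  show ?thesis
    unfolding D
    by (simp add: distrib_left distrib_right left_diff_distrib right_diff_distrib mult.assoc
        s2 r2 sw zw rz rw braid' assoc_rules \<tau>' mult_2)
qed

context complex_algebra
begin

text \<open>In \<open>D * D\<close> the part quadratic in \<open>z\<close> vanishes because
  \<open>(s + 1) * (s - 1) = 0\<close>; what remains is a scalar multiple of \<open>D\<close> in
  which \<open>u\<close> cancels.\<close>

lemma demazure_square:
  assumes s2: "s * s = 1" and sx: "s * x = - (x * s) - scale (2 * a + 2 * u) 1"
  shows "(scale a 1 + scale (1/2) ((scale (a - u) 1 + x) * (s - 1))) ^ 2 = scale (a ^ 2) 1"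
proof -
  define z where "z = scale (a - u) 1 + x"
  define D where "D = z * (s - 1)"
  \<comment> \<open>Moving \<open>s\<close> past \<open>z\<close> yields
    \<open>- (z * s) + c s - k\<close>: one half of \<open>c\<close> comes from the scalar part of
    \<open>z\<close>, the other from rewriting \<open>x\<close> as \<open>z - (a - u)\<close>. The
    sum \<open>c + k\<close> is \<open>4 * a\<close>.\<close>
  define c k where "c = 2 * (a - u)" and "k = 2 * a + 2 * u"
  have "scale c s = scale (a - u) s + scale (a - u) s"
    by (simp only: c_def mult_2 scale_left_distrib)
  then have "s * z = - (z * s) + scale c s - scale k 1"
    using sx by (simp add: z_def distrib_left distrib_right scale_mult_left scale_mult_right
        flip: k_def)
  then have "(s - 1) * z * (s - 1) = (- (z * s) + scale c s - scale k 1 - z) * (s - 1)"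
    by (simp add: left_diff_distrib)
  also have "\<dots> = - (scale c (s - 1) + scale k (s - 1))"
    using s2 by (simp add: distrib_right left_diff_distrib right_diff_distrib mult.assoc
        scale_mult_left scale_right_diff_distrib)
  also have "\<dots> = - scale (4 * a) (s - 1)"
    by (simp add: c_def k_def flip: scale_left_distrib)
  finally have "D * D = - scale (4 * a) D"
    by (simp add: D_def mult.assoc scale_mult_right)
  \<comment> \<open>The two cross terms of the square against
    \<open>D * D / 4 = - a D\<close>.\<close>
  moreover have "scale (a/2) D + (scale (a/2) D - scale a D) = 0"
    by (simp flip: scale_left_distrib scale_left_diff_distrib)
  ultimately have "(scale a 1 + scale (1/2) D) ^ 2 = scale (a ^ 2) 1"
    by (simp add: power2_eq_square distrib_left distrib_right scale_mult_left scale_mult_right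
        scale_right_distrib scale_right_diff_distrib)
  then show ?thesis by (simp add: D_def z_def)
qed

text \<open>Substituting \<open>a + D/2\<close> for \<open>T\<close>, the terms of degree at most
  one in \<open>D\<close> that carry no factor \<open>t\<close>, and the term \<open>t a r\<close>,
  agree on both sides; the rest is the relation for \<open>D\<close>.\<close>

lemma demazure_braid:
  assumes T: "T = scale a 1 + scale (1/2) ((scale b 1 + x) * (s - 1))"
    and "s * s = 1" and r2: "r * r = 1"
    and "r * s * r * s = s * r * s * r"
    and "s * y = y * s" and "x * y = y * x"
    and "r * x = y * r + scale t 1"
  shows "r * T * r * T + scale t (r * T) = T * r * T * r + scale t (T * r)"
proof -
  define D where "D = (scale b 1 + x) * (s - 1)"
  have T': "T = scale a 1 + scale (1/2) D" by (simp add: T D_def)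
  \<comment> \<open>The central element \<open>\<tau>\<close> of the ring identity is
    \<open>t\<close> times the unit.\<close>
  have double: "scale (2 * t) v = 2 * (scale t 1 * v)" for v
    by (simp only: scale_mult_left mult_1_left mult_2 scale_left_distrib)
  have "r * D * r * D + 2 * (scale t 1 * (r * D)) = D * r * D * r + 2 * (scale t 1 * (D * r))"
    by (rule ring_braid_relation[where w = "scale b 1 + y", OF D_def])
      (use assms in \<open>simp_all add: distrib_left distrib_right scale_mult_left scale_mult_right
        scale_right_distrib add_ac\<close>)
  \<comment> \<open>The factor 1/4 is the coefficient of \<open>r * D * r * D\<close> in
    \<open>r * T * r * T\<close>; it turns \<open>2 * t\<close> into the \<open>t/2\<close> that
    \<open>t r T\<close> contributes.\<close>
  then have "scale (1/4) (r * D * r * D + scale (2 * t) (r * D)) =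
      scale (1/4) (D * r * D * r + scale (2 * t) (D * r))"
    by (simp only: double)
  then have D_rel: "scale (1/4) (r * (D * (r * D))) + scale (t/2) (r * D) =
      scale (1/4) (D * (r * (D * r))) + scale (t/2) (D * r)"
    by (simp add: scale_right_distrib mult.assoc)
  have r2': "r * (r * v) = v" for v using r2 by (simp flip: mult.assoc)
  have "r * T * r * T + scale t (r * T) = scale (a * a) 1 + scale (a/2) D
      + scale (a/2) (r * (D * r)) + scale (t * a) r
      + (scale (1/4) (r * (D * (r * D))) + scale (t/2) (r * D))"
    unfolding T' by (simp add: distrib_left distrib_right scale_mult_left scale_mult_right
        scale_right_distrib mult.assoc r2 r2' add.assoc add.left_commute)
  moreover have "T * r * T * r + scale t (T * r) = scale (a * a) 1 + scale (a/2) D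
      + scale (a/2) (r * (D * r)) + scale (t * a) r
      + (scale (1/4) (D * (r * (D * r))) + scale (t/2) (D * r))"
    unfolding T' by (simp add: distrib_left distrib_right scale_mult_left scale_mult_right
        scale_right_distrib mult.assoc r2 r2' add.assoc add.left_commute)
  ultimately show ?thesis using D_rel by simp
qed

lemma commute_demazure:
  assumes "y * s = s * y" "y * x = x * y"
  shows "y * (scale a 1 + scale b ((scale c 1 + x) * (s - 1))) =
    (scale a 1 + scale b ((scale c 1 + x) * (s - 1))) * y"
proof -
  have "y * (x * s) = x * (s * y)" using assms by (metis mult.assoc)
  then show ?thesis using assms
    by (simp add: distrib_left distrib_right left_diff_distrib right_diff_distrib
        scale_mult_left scale_mult_right scale_right_distrib scale_right_diff_distrib mult.assoc)
qed

end

section \<open>The relations in the degenerate double affine Hecke algebra\<close>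

context degenerate_daha
begin

section \<open>Weyl group relations inside the algebra\<close>

abbreviation r :: "nat \<Rightarrow> 'a" where
  "r i \<equiv> \<rho> (affine_C_gen n i)"

lemma \<rho>_class:
  assumes "w \<in> lists {0..n}"
  shows "\<rho> (affine_C_cong n `` {w}) = (\<Prod>i\<leftarrow>w. r i)"
  using assms
proof (induction w rule: list.induct)
  case Nil
  then show ?case using \<rho>_one by (simp add: affine_C_def)
next
  case (Cons i w)
  have lists: "[i] \<in> lists {0..n}" "w \<in> lists {0..n}" using Cons.prems by auto
  show ?case
    using \<rho>_mult[OF affine_C_class_carrier[OF lists(1)] affine_C_class_carrier[OF lists(2)]]
      affine_C_mult[OF lists] Cons.IH[OF lists(2)] by (simp add: affine_C_gen_def)
qed

text \<open>Words related by a relator name the same group element, and \<open>\<rho>\<close> is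
  multiplicative on words.\<close>

lemma r_relator:
  assumes "(u, v) \<in> affine_C_relators n" "u \<in> lists {0..n}" "v \<in> lists {0..n}"
  shows "(\<Prod>i\<leftarrow>u. r i) = (\<Prod>i\<leftarrow>v. r i)"
proof -
  have "(u, v) \<in> affine_C_cong n"
    using affine_C_cong.relator[of u v n "[]" "[]"] assms by simp
  then have "affine_C_cong n `` {u} = affine_C_cong n `` {v}"
    by (rule equiv_class_eq[OF equiv_affine_C_cong])
  then show ?thesis using \<rho>_class assms(2,3) by metis
qed

section \<open>Cross-relations between reflections and coordinates\<close>

lemma peval_reflect:
  assumes "i \<le> n" "j \<in> {1..n}"
  shows "peval n scale X (reflect n i Var j) = reflect n i X j"
  using assms by (auto simp: reflect_def peval_diff peval_uminus)

text \<open>The cross-relation at \<open>p = Var j\<close>. In every use below the quotient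
  \<open>q\<close> is one of the constants 0, 1, -1.\<close>

lemma r_X:
  assumes "i \<le> n" "j \<in> {1..n}" "q \<in> Polys n"
    and "affine_root n i Var * q = reflect n i Var j - Var j"
  shows "r i * X j = reflect n i X j * r i
    + scale (daha_k n t0 u0 t tn un i) (peval n scale X q)"
  using cross[of i "Var j" q] assms
  by (simp add: reflect_poly_Var Var_Polys peval_reflect diff_eq_eq add.commute)

lemma r_X_commute:
  assumes "i \<le> n" "j \<in> {1..n}" "j \<noteq> i" "j \<noteq> i + 1"
  shows "r i * X j = X j * r i"
  \<comment> \<open>The reflection fixes \<open>x j\<close>, so the quotient is 0; the two
    inequalities also cover the end nodes, which move only \<open>x 1\<close> or only
    \<open>x n\<close>.\<close>
  using r_X[of i j 0] assms by (auto simp: zero_Polys reflect_def)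

lemma r_0_X_1:
  assumes "n \<ge> 1"
  shows "r 0 * X 1 = (1 - X 1) * r 0 + scale (2 * t0 + 2 * u0) 1"
  \<comment> \<open>Quotient 1: \<open>(1 - x 1) - x 1\<close> is the root itself.\<close>
  using r_X[of 0 1 1] assms by (simp add: one_Polys reflect_def affine_root_def daha_k_def)

lemma r_n_X_n:
  assumes "n \<ge> 1"
  shows "r n * X n = - (X n * r n) - scale (2 * tn + 2 * un) 1"
  \<comment> \<open>Quotient -1: \<open>- x n - x n\<close> is the negative of the root
    \<open>2 * x n\<close>.\<close>
  using r_X[of n n "- 1"] assms
  by (simp add: minus_one_Polys reflect_def affine_root_def daha_k_def peval_uminus)

lemma r_X_self:
  assumes "i \<in> {1..n-1}"
  shows "r i * X i = X (i+1) * r i - scale t 1"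
  using r_X[of i i "- 1"] assms
  by (auto simp: minus_one_Polys reflect_def affine_root_def daha_k_def peval_uminus)

lemma r_X_next:
  assumes "i \<in> {1..n-1}"
  shows "r i * X (i+1) = X i * r i + scale t 1"
  using r_X[of i "i+1" 1] assms
  by (auto simp: one_Polys reflect_def affine_root_def daha_k_def)

section \<open>The generators of \<open>H\<close>\<close>

abbreviation T :: "nat \<Rightarrow> 'a" where
  "T \<equiv> daha_T scale n t0 u0 tn un \<rho> X"

lemma T_0: "T 0 = scale t0 1 + scale (1/2) ((scale (t0 - u0) 1 + (scale (1/2) 1 - X 1)) * (r 0 - 1))"
  by (simp add: daha_T_def)

lemma T_n:
  "n > 0 \<Longrightarrow> T n = scale tn 1 + scale (1/2) ((scale (tn - un) 1 + X n) * (r n - 1))"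
  by (simp add: daha_T_def)

lemma T_middle: "i \<in> {1..n-1} \<Longrightarrow> T i = r i"
  unfolding daha_T_def Let_def by auto

lemma commute_T_0:
  assumes "y * r 0 = r 0 * y" "y * X 1 = X 1 * y"
  shows "y * T 0 = T 0 * y"
  unfolding T_0
  by (rule commute_demazure)
    (use assms in \<open>simp_all add: right_diff_distrib left_diff_distrib scale_mult_left scale_mult_right\<close>)

lemma commute_T_n:
  assumes "n > 0" "y * r n = r n * y" "y * X n = X n * y"
  shows "y * T n = T n * y"
  unfolding T_n[OF assms(1)] by (rule commute_demazure) fact+

section \<open>Quadratic and braid-type relations\<close>

lemma r_square:
  assumes "i \<le> n"
  shows "r i * r i = 1"
  using r_relator[OF affine_C_relatorI(1)[OF assms]] assms by simp

lemma r_braid4: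
  assumes "n \<ge> 1" "i = 0 \<or> i = n - 1"
  shows "r i * r (i+1) * r i * r (i+1) = r (i+1) * r i * r (i+1) * r i"
proof -
  have "i + 1 \<le> n" using assms by auto
  then show ?thesis
    using r_relator[OF affine_C_relatorI(2)[OF assms(2)]] by (simp add: mult.assoc)
qed

lemma T_0_square:
  assumes "n \<ge> 2"
  shows "T 0 ^ 2 = scale (t0 ^ 2) 1"
  unfolding T_0
proof (rule demazure_square)
  \<comment> \<open>The reflection sends \<open>X 1\<close> to \<open>1 - X 1\<close>, hence
    \<open>1/2 - X 1\<close> to its negative: the shift by 1/2 is what gives the sign rule of
    \<open>demazure_square\<close>.\<close>
  have "scale (1/2) (r 0) + scale (1/2) (r 0) = r 0" by (simp flip: scale_left_distrib)
  then show "r 0 * (scale (1/2) 1 - X 1) =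
      - ((scale (1/2) 1 - X 1) * r 0) - scale (2 * t0 + 2 * u0) 1"
    using r_0_X_1 assms
    by (simp add: right_diff_distrib left_diff_distrib scale_mult_left scale_mult_right algebra_simps)
qed (simp add: r_square assms)

lemma T_n_square:
  assumes "n \<ge> 2"
  shows "T n ^ 2 = scale (tn ^ 2) 1"
proof -
  have "n > 0" using assms by simp
  show ?thesis
    unfolding T_n[OF \<open>n > 0\<close>]
    by (rule demazure_square) (use assms r_n_X_n in \<open>simp_all add: r_square\<close>)
qed

lemma T_braid_0:
  assumes "n \<ge> 2"
  shows "T 0 * T 1 * T 0 * T 1 + scale t (T 0 * T 1) = T 1 * T 0 * T 1 * T 0 + scale t (T 1 * T 0)"
proof -
  have T1: "T 1 = r 1" using assms by (intro T_middle) auto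
  have "r 1 * T 0 * r 1 * T 0 + scale t (r 1 * T 0) = T 0 * r 1 * T 0 * r 1 + scale t (T 0 * r 1)"
  \<comment> \<open>Here \<open>r 1\<close> exchanges \<open>1/2 - X 1\<close> and
    \<open>1/2 - X 2\<close> up to \<open>t\<close>; the minus sign before \<open>X 1\<close> turns
    the \<open>- t\<close> of \<open>r_X_self\<close> into \<open>+ t\<close>.\<close>
  proof (rule demazure_braid[where y = "scale (1/2) 1 - X 2", OF T_0])
    show "r 0 * r 0 = 1" "r 1 * r 1 = 1" using assms by (simp_all add: r_square)
    show "r 1 * r 0 * r 1 * r 0 = r 0 * r 1 * r 0 * r 1" using r_braid4[of 0] assms by simp
    show "r 0 * (scale (1/2) 1 - X 2) = (scale (1/2) 1 - X 2) * r 0"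
      using r_X_commute[of 0 2] assms
      by (simp add: right_diff_distrib left_diff_distrib scale_mult_left scale_mult_right)
    show "(scale (1/2) 1 - X 1) * (scale (1/2) 1 - X 2) =
        (scale (1/2) 1 - X 2) * (scale (1/2) 1 - X 1)"
      using X_commute[of 1 2] assms
      by (simp add: right_diff_distrib left_diff_distrib scale_mult_left scale_mult_right algebra_simps)
    have "r 1 * X 1 = X 2 * r 1 - scale t 1"
      using r_X_self[of 1] assms by (simp add: numeral_2_eq_2)
    then show "r 1 * (scale (1/2) 1 - X 1) = (scale (1/2) 1 - X 2) * r 1 + scale t 1"
      by (simp add: right_diff_distrib left_diff_distrib scale_mult_left scale_mult_right)
  qed
  \<comment> \<open>\<open>demazure_braid\<close> starts with the plain reflection on the left, the
    claim with the end operator.\<close>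
  then show ?thesis unfolding T1 by (rule HOL.sym)
qed

lemma T_braid_n:
  assumes "n \<ge> 2"
  shows "T (n-1) * T n * T (n-1) * T n + scale t (T (n-1) * T n) =
    T n * T (n-1) * T n * T (n-1) + scale t (T n * T (n-1))"
proof -
  \<comment> \<open>As \<open>n \<ge> 2\<close>, the index \<open>n-1\<close> is a middle node, so
    \<open>T (n-1)\<close> is a plain reflection.\<close>
  have "n > 0" and Suc: "n - 1 + 1 = n" and mid: "n - 1 \<in> {1..n-1}" using assms by auto
  show ?thesis
    unfolding T_middle[OF mid]
  proof (rule demazure_braid[where y = "X (n-1)", OF T_n[OF \<open>n > 0\<close>]])
    show "r n * r n = 1" "r (n-1) * r (n-1) = 1" using assms by (simp_all add: r_square)
    show "r (n-1) * r n * r (n-1) * r n = r n * r (n-1) * r n * r (n-1)"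
      using r_braid4[of "n-1"] assms Suc by simp
    show "r n * X (n-1) = X (n-1) * r n"
      using assms by (intro r_X_commute) auto
    show "X n * X (n-1) = X (n-1) * X n"
      using assms by (intro X_commute) auto
    show "r (n-1) * X n = X (n-1) * r (n-1) + scale t 1"
      using r_X_next[OF mid] Suc by simp
  qed
qed

lemma T_braid_middle:
  assumes "n \<ge> 2" "i \<in> {1..n-2}"
  shows "T i * T (i+1) * T i = T (i+1) * T i * T (i+1)"
proof -
  have "T i = r i" "T (i+1) = r (i+1)" "i + 1 \<le> n" using assms by (auto intro!: T_middle)
  then show ?thesis
    using r_relator[OF affine_C_relatorI(3)[of i n]] assms by (simp add: mult.assoc)
qed

text \<open>Only \<open>i\<close> can be the node 0 and only \<open>j\<close> the node
  \<open>n\<close>. So \<open>T i\<close> is built from \<open>r i\<close> and possibly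
  \<open>X 1\<close>, \<open>T j\<close> from \<open>r j\<close> and possibly \<open>X n\<close>,
  and these ingredients commute pairwise.\<close>

lemma T_commute_less:
  assumes "n \<ge> 2" "j \<le> n" "i + 2 \<le> j"
  shows "T i * T j = T j * T i"
proof -
  have "r i * r j = r j * r i"
    using r_relator[OF affine_C_relatorI(4)[of i n j]] assms by simp
  moreover have "r j * X 1 = X 1 * r j" using assms by (intro r_X_commute) auto
  ultimately have rj: "r j * T i = T i * r j"
    using assms T_middle[of i] commute_T_0[of "r j"] by (cases "i = 0") auto
  show ?thesis
  proof (cases "j = n")
    case False
    then show ?thesis using rj T_middle[of j] assms by simp
  next
    case True
    have "X n * r i = r i * X n" using r_X_commute[of i n] assms by simp
    moreover have "X n * X 1 = X 1 * X n" using assms by (intro X_commute) auto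
    ultimately have "X n * T i = T i * X n"
      using assms T_middle[of i] commute_T_0[of "X n"] by (cases "i = 0") auto
    then show ?thesis using commute_T_n[of "T i"] rj True assms by simp
  qed
qed

end

theorem proposition2p2:
  fixes n :: nat and t0 u0 t tn un :: complex
    and scale :: "complex \<Rightarrow> 'a::ring_1 \<Rightarrow> 'a"
    and \<rho> :: "nat list set \<Rightarrow> 'a" and X :: "nat \<Rightarrow> 'a"
    and T :: "nat \<Rightarrow> 'a" and H :: "'a set"
  assumes "n \<ge> 2"
    and "degenerate_daha scale n t0 u0 t tn un \<rho> X"
    and "T = daha_T scale n t0 u0 tn un \<rho> X"
    and "H = daha_H scale n t0 u0 tn un \<rho> X"
  shows "(\<forall>i\<in>{0..n}. T i \<in> H) \<and>
    T 0 ^ 2 = scale (t0 ^ 2) 1 \<and>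
    T n ^ 2 = scale (tn ^ 2) 1 \<and>
    (\<forall>i\<in>{1..n-1}. T i ^ 2 = 1) \<and>
    (\<forall>i\<in>{0, n-1}.
       T i * T (i+1) * T i * T (i+1) + scale t (T i * T (i+1))
       = T (i+1) * T i * T (i+1) * T i + scale t (T (i+1) * T i)) \<and>
    (\<forall>i\<in>{1..n-2}. T i * T (i+1) * T i = T (i+1) * T i * T (i+1)) \<and>
    (\<forall>i\<in>{0..n}. \<forall>j\<in>{0..n}. \<bar>int i - int j\<bar> \<ge> 2 \<longrightarrow> T i * T j = T j * T i)"
proof -
  interpret D: degenerate_daha scale n t0 u0 t tn un \<rho> X by (fact assms(2))
  note T = assms(3) and n = assms(1)
  have Suc: "n - 1 + 1 = n" using n by simp
  have "T i \<in> H" if "i \<in> {0..n}" for i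
    unfolding assms(3,4) daha_H_def using that by (intro subalgebra_gen.gen imageI)
  moreover have "T i ^ 2 = 1" if "i \<in> {1..n-1}" for i
  proof -
    have "i \<le> n" using that by auto
    then show ?thesis
      using D.T_middle[OF that] D.r_square by (simp add: T power2_eq_square)
  qed
  moreover have "T i * T (i+1) * T i * T (i+1) + scale t (T i * T (i+1))
      = T (i+1) * T i * T (i+1) * T i + scale t (T (i+1) * T i)" if "i \<in> {0, n-1}" for i
  proof (cases "i = 0")
    case True
    then show ?thesis using D.T_braid_0[OF n] T by simp
  next
    case False
    then have "i = n - 1" using that by simp
    then show ?thesis using D.T_braid_n[OF n] T Suc by simp
  qed
  moreover have "T i * T j = T j * T i"
    if "i \<in> {0..n}" "j \<in> {0..n}" "\<bar>int i - int j\<bar> \<ge> 2" for i j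
  proof -
    \<comment> \<open>Commutation is symmetric, so either order of the indices reduces to
      \<open>T_commute_less\<close>.\<close>
    have "i + 2 \<le> j \<or> j + 2 \<le> i" using that(3) by linarith
    then show ?thesis
      using D.T_commute_less[OF n, of j i] D.T_commute_less[OF n, of i j] that(1,2) T by auto
  qed
  ultimately show ?thesis
    using D.T_0_square[OF n] D.T_n_square[OF n] D.T_braid_middle[OF n] T by blast
qed

end
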